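(* Let $q\ge 2$ be a fixed even integer. For even positive integers $n$, the minimum redundancy $r_{\rm PB}(n,q)$ of polarity-balanced codes of length $n$ over ${\cal A}_q$ satisfies $$r_{\rm PB}(n,q)=n-\log_q M_{\rm PB}(n,q)\approx \frac12\log_q n+\frac12\log_q\frac{\pi}{2},$$ where $\approx$ means that the difference of the two sides tends to $0$ as $n\to\infty$ through even integers.
   Context: For an integer $q\ge 2$, ${\cal A}_q=\{-q+1,-q+3,-q+5,\ldots,q-3,q-1\}$. A sequence ${\bf x}=(x_1,\ldots,x_n)\in({\cal A}_q)^n$ is polarity-balanced (PB) if $|\{i:x_i>0\}|=|\{i:x_i<0\}|$; $M_{\rm PB}(n,q)$ is the number of PB sequences in $({\cal A}_q)^n$. A code of length $n$ is a set of sequences of length $n$; it is PB if all its codewords are PB. The redundancy of a $q$-ary code of length $n$ and size $M$ is $n-\log_q M$, and $r_{\rm PB}(n,q)$ is the minimum redundancy among (nonempty) PB codes of length $n$ over ${\cal A}_q$. *)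

theory Defs
  imports "HOL-Analysis.Analysis"
begin

definition alphabet :: "nat \<Rightarrow> int set" where
  "alphabet q = {1 - int q + 2 * int j | j. j < q}"

definition sequences :: "nat \<Rightarrow> nat \<Rightarrow> int list set" where
  "sequences n q = {x. length x = n \<and> set x \<subseteq> alphabet q}"

definition polarity_balanced :: "int list \<Rightarrow> bool" where
  "polarity_balanced x \<longleftrightarrow>
     card {i. i < length x \<and> x ! i > 0} = card {i. i < length x \<and> x ! i < 0}"

definition M_PB :: "nat \<Rightarrow> nat \<Rightarrow> nat" where
  "M_PB n q = card {x \<in> sequences n q. polarity_balanced x}"

definition is_code :: "nat \<Rightarrow> nat \<Rightarrow> int list set \<Rightarrow> bool" where
  "is_code n q C \<longleftrightarrow> C \<subseteq> sequences n q"

definition PB_code :: "nat \<Rightarrow> nat \<Rightarrow> int list set \<Rightarrow> bool" where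
  "PB_code n q C \<longleftrightarrow> is_code n q C \<and> (\<forall>x\<in>C. polarity_balanced x)"

definition redundancy :: "nat \<Rightarrow> nat \<Rightarrow> int list set \<Rightarrow> real" where
  "redundancy n q C = real n - log (real q) (real (card C))"

(* There are finitely many codes of length n, so Min is a genuine minimum whenever a
   nonempty PB code exists. For odd n and even q there is none (no symbol is 0), and
   then the value is unspecified. *)
definition r_PB :: "nat \<Rightarrow> nat \<Rightarrow> real" where
  "r_PB n q = Min {redundancy n q C | C. PB_code n q C \<and> C \<noteq> {}}"

end

theory Submission
  imports Defs "HOL-Real_Asymp.Real_Asymp"
begin

text \<open>For even \<open>q\<close> no symbol vanishes and \<open>q/2\<close> symbols have each sign, so the polarity-balanced
  sequences of length \<open>2m\<close> number \<open>(2m choose m) (q/2)\<^sup>2\<^sup>m\<close> and the redundancy is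
  \<open>log\<^sub>q (4\<^sup>m / (2m choose m))\<close>. The square of the argument is \<open>2m + 1\<close> times the \<open>m\<close>-th partial
  product of Wallis' formula, hence asymptotically \<open>m \<pi>\<close>.\<close>

section \<open>Counting polarity-balanced sequences\<close>

lemma length_filter_plus_eq_length:
  assumes "set x \<subseteq> P \<union> N" "P \<inter> N = {}"
  shows "length (filter (\<lambda>a. a \<in> P) x) + length (filter (\<lambda>a. a \<in> N) x) = length x"
  using assms by (induction x) auto

text \<open>Induction on the length, splitting off the first entry: an entry from \<open>P\<close>
  uses up one of the \<open>k\<close> positions, an entry from \<open>N\<close> none. This is
  Pascal's rule weighted by \<open>card P\<close> and \<open>card N\<close>.\<close>

lemma card_lists_filter_length:
  assumes "finite P" "finite N" "P \<inter> N = {}"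
  shows "card {x. length x = n \<and> set x \<subseteq> P \<union> N \<and> length (filter (\<lambda>a. a \<in> P) x) = k}
           = (n choose k) * card P ^ k * card N ^ (n - k)"
proof -
  define L where "L n k = {x. length x = n \<and> set x \<subseteq> P \<union> N \<and> length (filter (\<lambda>a. a \<in> P) x) = k}"
    for n k
  have fin: "finite (L n k)" for n k
    by (rule finite_subset[OF _ finite_lists_length_eq[of "P \<union> N" n]])
      (use assms in \<open>auto simp: L_def\<close>)
  have card_Cons: "card ((\<lambda>(a, x). a # x) ` (A \<times> B)) = card A * card B"
    for A :: "'a set" and B
    by (subst card_image) (auto simp: inj_on_def card_cartesian_product)
  have L_0: "L 0 k = (if k = 0 then {[]} else {})" for k
    by (auto simp: L_def)
  have L_Suc_0: "L (Suc n) 0 = (\<lambda>(a, x). a # x) ` (N \<times> L n 0)" for n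
    using assms(3) by (auto simp: L_def length_Suc_conv image_iff split: if_splits)
  have Cons_in_L: "a # x \<in> L (Suc n) (Suc k) \<longleftrightarrow> a \<in> P \<and> x \<in> L n k \<or> a \<in> N \<and> x \<in> L n (Suc k)"
    for a x n k
    using assms(3) by (cases "a \<in> P") (auto simp: L_def)
  have L_Suc_Suc: "L (Suc n) (Suc k) =
      (\<lambda>(a, x). a # x) ` (P \<times> L n k) \<union> (\<lambda>(a, x). a # x) ` (N \<times> L n (Suc k))"
    (is "_ = ?R") for n k
  proof (rule set_eqI)
    fix y
    show "y \<in> L (Suc n) (Suc k) \<longleftrightarrow> y \<in> ?R"
    proof (cases y)
      case Nil
      then show ?thesis by (auto simp: L_def)
    next
      case (Cons a x)
      then show ?thesis by (auto simp: Cons_in_L)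
    qed
  qed
  have "card (L n k) = (n choose k) * card P ^ k * card N ^ (n - k)"
  proof (induction n arbitrary: k)
    case 0
    then show ?case by (cases k) (auto simp: L_0)
  next
    case (Suc n)
    show ?case
    proof (cases k)
      case 0
      then show ?thesis by (simp add: L_Suc_0 card_Cons Suc)
    next
      case (Suc j)
      have "card (L (Suc n) (Suc j)) = card P * card (L n j) + card N * card (L n (Suc j))"
        unfolding L_Suc_Suc
        by (subst card_Un_disjoint)
          (use assms fin in \<open>auto simp: card_Cons intro!: finite_imageI\<close>)
      also have "card N * card (L n (Suc j))
          = (n choose Suc j) * card P ^ Suc j * card N ^ (n - j)"
      \<comment> \<open>For \<open>j \<ge> n\<close> the truncated exponent \<open>n - Suc j\<close>
        is 0 and the exponents need not match, but then \<open>n choose Suc j\<close>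
        vanishes.\<close>
      proof (cases "j < n")
        case True
        then have "card N ^ (n - j) = card N * card N ^ (n - Suc j)"
          by (metis Suc_diff_Suc power_Suc)
        then show ?thesis by (simp add: Suc.IH)
      next
        case False
        then show ?thesis by (simp add: Suc.IH binomial_eq_0)
      qed
      finally show ?thesis
        using Suc by (simp add: Suc.IH algebra_simps)
    qed
  qed
  then show ?thesis by (simp add: L_def)
qed

text \<open>All symbols are odd, which excludes 0. The increasing enumeration \<open>f\<close>
  passes from -1 to 1 between the indices \<open>h - 1\<close> and \<open>h\<close>, so the halves
  of the index range \<open>{..<2 * h}\<close> give the two signs.\<close>

lemma alphabet_even:
  "alphabet (2 * h) = {a \<in> alphabet (2 * h). a > 0} \<union> {a \<in> alphabet (2 * h). a < 0}"
  "card {a \<in> alphabet (2 * h). a > 0} = h"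
  "card {a \<in> alphabet (2 * h). a < 0} = h"
proof -
  define f where "f j = 1 - int (2 * h) + 2 * int j" for j
  have alph: "alphabet (2 * h) = f ` {..<2 * h}"
    by (auto simp: alphabet_def f_def)
  have f_pos: "f j > 0 \<longleftrightarrow> h \<le> j" and f_neg: "f j < 0 \<longleftrightarrow> j < h" for j
    unfolding f_def by auto
  have inj: "inj_on f A" for A
    by (auto simp: inj_on_def f_def)
  have filter_image: "{a \<in> f ` A. Q a} = f ` {j \<in> A. Q (f j)}" for A Q
    by blast
  have "{j \<in> {..<2 * h}. h \<le> j} = {h..<2 * h}" by auto
  then show "card {a \<in> alphabet (2 * h). a > 0} = h"
    by (simp add: alph filter_image f_pos card_image[OF inj])
  have "{j \<in> {..<2 * h}. j < h} = {..<h}" by auto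
  then show "card {a \<in> alphabet (2 * h). a < 0} = h"
    by (simp add: alph filter_image f_neg card_image[OF inj])
  have "0 \<notin> alphabet (2 * h)"
    by (auto simp: alphabet_def) presburger
  then show "alphabet (2 * h) = {a \<in> alphabet (2 * h). a > 0} \<union> {a \<in> alphabet (2 * h). a < 0}"
    by (auto simp: neq_iff) (metis linorder_neqE)
qed

lemma finite_alphabet: "finite (alphabet q)"
proof -
  have "alphabet q = (\<lambda>j. 1 - int q + 2 * int j) ` {..<q}"
    by (auto simp: alphabet_def)
  then show ?thesis by simp
qed

lemma finite_sequences: "finite (sequences n q)"
  using finite_lists_length_eq[OF finite_alphabet, of q n]
  by (simp add: sequences_def conj_commute)

text \<open>As no symbol is 0, the numbers of positive and negative entries add up to
  \<open>2 * m\<close>; they agree exactly when the first is \<open>m\<close>. Each sign offers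
  \<open>h\<close> symbols, whence \<open>h ^ m * h ^ m\<close>.\<close>

lemma M_PB_even: "M_PB (2 * m) (2 * h) = (2 * m choose m) * h ^ (2 * m)"
proof -
  define P where "P = {a \<in> alphabet (2 * h). a > 0}"
  define N where "N = {a \<in> alphabet (2 * h). a < 0}"
  note alph = alphabet_even[of h, folded P_def N_def]
  have PN: "P \<inter> N = {}" "finite P" "finite N"
    using finite_alphabet by (auto simp: P_def N_def)
  have "polarity_balanced x \<longleftrightarrow> length (filter (\<lambda>a. a \<in> P) x) = m"
    if x: "length x = 2 * m" "set x \<subseteq> alphabet (2 * h)" for x
  proof -
    have "filter (\<lambda>a. a \<in> P) x = filter (\<lambda>a. a > 0) x"
      "filter (\<lambda>a. a \<in> N) x = filter (\<lambda>a. a < 0) x"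
      using x by (auto simp: P_def N_def intro!: filter_cong)
    then have "polarity_balanced x \<longleftrightarrow>
        length (filter (\<lambda>a. a \<in> P) x) = length (filter (\<lambda>a. a \<in> N) x)"
      by (simp add: polarity_balanced_def length_filter_conv_card)
    moreover have "length (filter (\<lambda>a. a \<in> P) x) + length (filter (\<lambda>a. a \<in> N) x) = 2 * m"
      using length_filter_plus_eq_length[of x P N] x alph(1) PN by simp
    ultimately show ?thesis by linarith
  qed
  then have "{x \<in> sequences (2 * m) (2 * h). polarity_balanced x}
      = {x. length x = 2 * m \<and> set x \<subseteq> P \<union> N \<and> length (filter (\<lambda>a. a \<in> P) x) = m}"
    unfolding sequences_def using alph(1) by auto
  then show ?thesis
    using card_lists_filter_length[OF PN(2,3,1), of "2 * m" m] alph(2,3)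
    by (simp add: M_PB_def mult_2 power_add)
qed

section \<open>The minimum redundancy\<close>

text \<open>Redundancy decreases as the code grows, and the PB codes are exactly the subsets of the
  set \<open>S\<close> of all PB sequences, so \<open>S\<close> itself attains the minimum.\<close>

lemma r_PB_eq:
  assumes "q \<ge> 2" "M_PB n q > 0"
  shows "r_PB n q = real n - log (real q) (real (M_PB n q))"
proof -
  define S where "S = {x \<in> sequences n q. polarity_balanced x}"
  have fin: "finite S"
    using finite_sequences by (simp add: S_def)
  have card_S: "card S = M_PB n q"
    by (simp add: S_def M_PB_def)
  have code: "PB_code n q C \<longleftrightarrow> C \<subseteq> S" for C
    by (auto simp: PB_code_def is_code_def S_def)
  have "Min {redundancy n q C | C. C \<subseteq> S \<and> C \<noteq> {}} = redundancy n q S"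
  proof (rule Min_eqI)
    have "{redundancy n q C | C. C \<subseteq> S \<and> C \<noteq> {}} \<subseteq> redundancy n q ` Pow S"
      by auto
    then show "finite {redundancy n q C | C. C \<subseteq> S \<and> C \<noteq> {}}"
      using fin by (meson finite_Pow_iff finite_imageI finite_subset)
  next
    fix y assume "y \<in> {redundancy n q C | C. C \<subseteq> S \<and> C \<noteq> {}}"
    then obtain C where C: "y = redundancy n q C" "C \<subseteq> S" "C \<noteq> {}" by auto
    \<comment> \<open>Positivity matters because the logarithm is monotone only on positive
      arguments.\<close>
    then have "0 < card C" "card C \<le> card S"
      using fin by (auto simp: card_gt_0_iff card_mono intro: finite_subset)
    then show "redundancy n q S \<le> y"
      using C(1) assms(1) by (simp add: redundancy_def)
  next
    have "S \<noteq> {}" using assms(2) card_S by auto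
    then show "redundancy n q S \<in> {redundancy n q C | C. C \<subseteq> S \<and> C \<noteq> {}}" by auto
  qed
  then show ?thesis
    by (simp add: r_PB_def code redundancy_def card_S)
qed

section \<open>Asymptotics of the central binomial coefficient\<close>

text \<open>The Wallis denominators factor as \<open>(2 * k - 1) * (2 * k + 1)\<close>, so every odd
  number below \<open>2 * m + 1\<close> occurs squared and the extra factor cancels the unpaired
  \<open>2 * m + 1\<close>. In the induction both sides gain the factor
  \<open>(2 * s / t) ^ 2\<close>.\<close>

lemma wallis_product_eq_central_binomial:
  "(\<Prod>k=1..m. (4 * real k ^ 2) / (4 * real k ^ 2 - 1)) * (2 * real m + 1)
     = (4 ^ m / real (2 * m choose m)) ^ 2"
proof (induction m)
  case (Suc m)
  define W where "W = (\<Prod>k=1..m. (4 * real k ^ 2) / (4 * real k ^ 2 - 1))"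
  define c where "c = real (2 * m choose m)"
  define s t u where "s = real (Suc m)" and "t = 2 * real m + 1" and "u = 2 * real (Suc m) + 1"
  have pos: "c > 0" "s > 0" "t > 0" "u > 0"
    by (auto simp: c_def s_def t_def u_def)
  \<comment> \<open>The recursion passes through row \<open>2 * m + 1\<close>: absorption, then
    symmetry of that odd row, then absorption again.\<close>
  have "Suc m * (2 * Suc m choose Suc m) = 2 * (Suc m * (Suc (2 * m) choose m))"
    using Suc_times_binomial[of m "Suc (2 * m)"] by simp
  also have "Suc (2 * m) choose m = Suc (2 * m) choose Suc m"
    using binomial_symmetric[of m "Suc (2 * m)"] by simp
  also have "Suc m * (Suc (2 * m) choose Suc m) = Suc (2 * m) * (2 * m choose m)"
    by (rule Suc_times_binomial)
  finally have "real (Suc m * (2 * Suc m choose Suc m)) = real (2 * (Suc (2 * m) * (2 * m choose m)))"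
    by (rule arg_cong)
  then have "s * real (2 * Suc m choose Suc m) = 2 * (t * c)"
    unfolding of_nat_mult c_def s_def t_def by simp
  then have step: "real (2 * Suc m choose Suc m) = 2 * (t * c) / s"
    using pos by (simp add: field_simps)
  have factor: "4 * real (Suc m) ^ 2 - 1 = t * u"
    by (simp add: t_def u_def power2_eq_square algebra_simps)
  have "(\<Prod>k=1..Suc m. (4 * real k ^ 2) / (4 * real k ^ 2 - 1)) = W * (4 * s ^ 2 / (t * u))"
    using factor by (simp add: W_def s_def)
  then have "(\<Prod>k=1..Suc m. (4 * real k ^ 2) / (4 * real k ^ 2 - 1)) * u = W * t * (2 * s / t) ^ 2"
    using pos by (simp add: field_simps power2_eq_square)
  also have "\<dots> = (4 ^ m / c * (2 * s / t)) ^ 2"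
    using Suc.IH by (simp only: W_def t_def c_def power_mult_distrib)
  also have "4 ^ m / c * (2 * s / t) = 4 ^ Suc m / (2 * (t * c) / s)"
    using pos by (simp add: field_simps)
  finally show ?case
    by (simp only: step u_def)
qed simp

text \<open>Half the logarithm of the squared quotient is the claimed difference. By Wallis' formula
  that square, divided by \<open>m * pi\<close>, tends to \<open>pi / 2 * (2 / pi) = 1\<close>, and
  the logarithm is continuous at 1.\<close>

lemma log_central_binomial_tendsto:
  assumes "b > 1"
  shows "(\<lambda>m. log b (4 ^ m / real (2 * m choose m)) - 1/2 * log b (real m * pi)) \<longlonglongrightarrow> 0"
proof -
  define W where "W m = (\<Prod>k=1..m. (4 * real k ^ 2) / (4 * real k ^ 2 - 1))" for m
  have "(\<lambda>m. W m * ((2 * real m + 1) / (real m * pi))) \<longlonglongrightarrow> pi / 2 * (2 / pi)"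
    unfolding W_def
  proof (intro tendsto_mult wallis)
    have "(\<lambda>m. (2 * real m + 1) / real m) \<longlonglongrightarrow> 2" by real_asymp
    then have "(\<lambda>m. (2 * real m + 1) / real m / pi) \<longlonglongrightarrow> 2 / pi"
      by (intro tendsto_divide tendsto_const) auto
    then show "(\<lambda>m. (2 * real m + 1) / (real m * pi)) \<longlonglongrightarrow> 2 / pi" by simp
  qed
  then have "(\<lambda>m. 1/2 * log b (W m * ((2 * real m + 1) / (real m * pi)))) \<longlonglongrightarrow> 1/2 * log b 1"
    using assms by (intro tendsto_mult tendsto_const tendsto_log) auto
  moreover have "\<forall>\<^sub>F m in sequentially.
      1/2 * log b (W m * ((2 * real m + 1) / (real m * pi)))
        = log b (4 ^ m / real (2 * m choose m)) - 1/2 * log b (real m * pi)"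
    \<comment> \<open>At \<open>m = 0\<close> the divisor \<open>real m * pi\<close> is 0, so the
      quotient rule for logarithms would not apply.\<close>
    using eventually_gt_at_top[of 0]
  proof eventually_elim
    case (elim m)
    define c where "c = 4 ^ m / real (2 * m choose m)"
    have "c > 0" by (simp add: c_def)
    have "W m * ((2 * real m + 1) / (real m * pi)) = c ^ 2 / (real m * pi)"
      using wallis_product_eq_central_binomial[of m] by (simp add: W_def c_def)
    also have "1/2 * log b \<dots> = log b c - 1/2 * log b (real m * pi)"
      using elim assms \<open>c > 0\<close> by (simp add: log_divide log_nat_power algebra_simps)
    finally show ?case by (simp add: c_def)
  qed
  ultimately show ?thesis
    by (simp only: log_one mult_zero_right) (rule Lim_transform_eventually)
qed

theorem corollary6:
  fixes q :: nat
  assumes "q \<ge> 2" and "even q"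
  shows "(\<forall>n. even n \<and> n > 0 \<longrightarrow> r_PB n q = real n - log (real q) (real (M_PB n q))) \<and>
    ((\<lambda>n. r_PB n q - (1/2 * log (real q) (real n) + 1/2 * log (real q) (pi / 2)))
       \<longlongrightarrow> 0) (inf sequentially (principal {n. even n}))"
proof -
  obtain h where q: "q = 2 * h" using assms(2) by blast
  have h: "h > 0" and q1: "real q > 1" using assms(1) q by auto
  have r_eq: "r_PB n q = real n - log (real q) (real (M_PB n q))" if "even n" for n
  proof -
    from that obtain m where "n = 2 * m" by blast
    then have "M_PB n q > 0" using h by (simp add: q M_PB_even)
    with assms(1) show ?thesis by (rule r_PB_eq)
  qed
  have r_even: "r_PB (2 * m) q = log q (4 ^ m / real (2 * m choose m))" for m
  proof -
    \<comment> \<open>Since \<open>h = q / 2\<close>, the power \<open>h ^ (2 * m)\<close> equals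
      \<open>q ^ (2 * m) / 4 ^ m\<close>; the logarithm of its numerator cancels the length
      \<open>2 * m\<close> in the redundancy.\<close>
    have "real (M_PB (2 * m) q) = real q ^ (2 * m) / (4 ^ m / real (2 * m choose m))"
      by (simp add: q M_PB_even power_mult_distrib power_mult)
    moreover have "4 ^ m / real (2 * m choose m) > 0" by simp
    ultimately have "log q (real (M_PB (2 * m) q))
        = real (2 * m) - log q (4 ^ m / real (2 * m choose m))"
      using q1 by (simp only: log_divide_pos zero_less_power log_nat_power log_eq_one)
    then show ?thesis by (simp add: r_eq)
  qed
  define F where "F = inf sequentially (principal {n :: nat. even n})"
  \<comment> \<open>The limit in \<open>m\<close> is pulled back along \<open>n div 2\<close>, which
    tends to infinity over all \<open>n\<close> and therefore also along the finer filter
    \<open>F\<close> of even \<open>n\<close>.\<close>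
  have "filterlim (\<lambda>n :: nat. n div 2) sequentially sequentially"
    by (rule filterlim_at_top_div_const_nat) simp
  then have "filterlim (\<lambda>n. n div 2) sequentially F"
    unfolding F_def by (rule filterlim_mono) auto
  with log_central_binomial_tendsto[OF q1]
  have "((\<lambda>n. log q (4 ^ (n div 2) / real (2 * (n div 2) choose (n div 2)))
      - 1/2 * log q (real (n div 2) * pi)) \<longlongrightarrow> 0) F"
    by (rule filterlim_compose)
  moreover have "\<forall>\<^sub>F n in F.
      log q (4 ^ (n div 2) / real (2 * (n div 2) choose (n div 2))) - 1/2 * log q (real (n div 2) * pi)
        = r_PB n q - (1/2 * log (real q) (real n) + 1/2 * log (real q) (pi / 2))"
    unfolding F_def eventually_inf_principal
    using eventually_gt_at_top[of 0]
  proof eventually_elim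
    case (elim n)
    show ?case
    proof
      assume "n \<in> {n. even n}"
      then obtain m where n: "n = 2 * m" by blast
      \<comment> \<open>The constant \<open>pi / 2\<close> arises here: with
        \<open>n = 2 * m\<close>, the product \<open>n * (pi / 2)\<close> is
        \<open>m * pi\<close>.\<close>
      have "log q (real n) + log q (pi / 2) = log q (real n * (pi / 2))"
        using elim q1 by (subst log_mult) auto
      then have "log q (real n) + log q (pi / 2) = log q (real m * pi)"
        by (simp add: n)
      then show "log q (4 ^ (n div 2) / real (2 * (n div 2) choose (n div 2)))
          - 1/2 * log q (real (n div 2) * pi)
          = r_PB n q - (1/2 * log (real q) (real n) + 1/2 * log (real q) (pi / 2))"
        using r_even[of m] by (simp add: n)
    qed
  qed
  ultimately show ?thesis
    using r_eq unfolding F_def by (blast intro: Lim_transform_eventually)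
qed

end
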